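(* Let $d\in\mathbb N$, $a\in\mathbb N_0$. For all integers $n\ge k\ge0$, $$rEu(d,a;n,k)=\sum_{m=0}^n\binom{n}{m}a^{n-m}d^m\sum_{p=0}^k(-1)^{k-p}\binom{n-m}{k-p}\,rEu(m,p),$$ where $rEu(m,p):=rEu(1,0;m,p)$.
   Context: $\mathbb N=\{1,2,\dots\}$, $\mathbb N_0=\{0,1,2,\dots\}$, $0^0:=1$. For $d\in\mathbb N$, $a\in\mathbb N_0$, the generalized Stirling numbers of the second kind $S2(d,a;n,m)$, $0\le m\le n$, are defined by the operator identity $(a\,\mathbf 1+d\,\mathbf E_x)^n=\sum_{m=0}^n S2(d,a;n,m)\,x^m\,\mathbf d_x^{\,m}$, where $\mathbf d_x$ is differentiation with respect to $x$, $\mathbf E_x:=x\,\mathbf d_x$ and $\mathbf 1$ is the identity operator. The generalized (row reversed) Eulerian numbers are defined, for $0\le k\le n$, by $rEu(d,a;n,k):=\sum_{j=0}^k(-1)^{k-j}\binom{n-j}{k-j}S2(d,a;n,j)\,j!$, and $rEu(d,a;n,k):=0$ for $k>n$. *)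

theory Defs
  imports "HOL-Computational_Algebra.Polynomial"
begin

text \<open>Operators act on real polynomials in \<open>x\<close>; powers of operators are iterated
  compositions, so \<open>T ^^ n\<close> is the \<open>n\<close>-th power of \<open>T\<close>.\<close>

definition Euler_op :: "real poly \<Rightarrow> real poly"
  where "Euler_op p = monom 1 1 * pderiv p"

definition affine_Euler_op :: "nat \<Rightarrow> nat \<Rightarrow> real poly \<Rightarrow> real poly"
  where "affine_Euler_op d a p = smult (real a) p + smult (real d) (Euler_op p)"

definition is_S2_row :: "nat \<Rightarrow> nat \<Rightarrow> nat \<Rightarrow> (nat \<Rightarrow> real) \<Rightarrow> bool"
  where "is_S2_row d a n c \<longleftrightarrow>
    (\<forall>p. (affine_Euler_op d a ^^ n) p = (\<Sum>m\<le>n. smult (c m) (monom 1 m * (pderiv ^^ m) p)))"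

text \<open>The operator identity only determines the coefficients with \<open>m \<le> n\<close>; the others are set
  to \<open>0\<close> so that the row is unique.\<close>

definition S2 :: "nat \<Rightarrow> nat \<Rightarrow> nat \<Rightarrow> nat \<Rightarrow> real"
  where "S2 d a n = (THE c. is_S2_row d a n c \<and> (\<forall>m>n. c m = 0))"

definition rEu :: "nat \<Rightarrow> nat \<Rightarrow> nat \<Rightarrow> nat \<Rightarrow> real"
  where "rEu d a n k =
    (if k \<le> n then \<Sum>j\<le>k. (-1) ^ (k - j) * real ((n - j) choose (k - j)) * S2 d a n j * fact j
     else 0)"

text \<open>The defining operator identity has exactly one solution, so the description operator in
  \<open>S2\<close> is meaningful.\<close>

lemma is_S2_row_exists: "\<exists>c. is_S2_row d a n c \<and> (\<forall>m>n. c m = 0)"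
proof (induction n)
  case 0
  show ?case
    by (rule exI[of _ "\<lambda>m. if m = 0 then 1 else 0"]) (simp add: is_S2_row_def)
next
  case (Suc n)
  then obtain c where c: "is_S2_row d a n c" and z: "\<And>m. m > n \<Longrightarrow> c m = 0" by blast
  define T where "T = (\<lambda>m (p :: real poly). monom 1 m * (pderiv ^^ m) p)"
  define c' where "c' m = (real a + real d * real m) * c m
      + (if m = 0 then 0 else real d * c (m - 1))" for m
  have ET: "Euler_op (T m p) = smult (real m) (T m p) + T (Suc m) p" for m p
  proof (cases m)
    case 0
    then show ?thesis by (simp add: T_def Euler_op_def)
  next
    case (Suc l)
    have "monom (1::real) 1 * (monom 1 l * q) = monom 1 (Suc l) * q"
         "monom (1::real) 1 * (monom 1 (Suc l) * q) = monom 1 (Suc (Suc l)) * q" for q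
      by (simp_all add: mult_monom flip: mult.assoc)
    moreover have "pderiv (monom (1::real) (Suc l)) = smult (real (Suc l)) (monom 1 l)"
      by (simp add: pderiv_monom smult_monom)
    ultimately show ?thesis
      unfolding Suc T_def Euler_op_def pderiv_mult funpow.simps o_apply
        mult.commute[of "pderiv ((pderiv ^^ l) p)"]
      by (simp only: distrib_left mult_smult_left mult_smult_right add.commute)
  qed
  have lin: "affine_Euler_op d a (\<Sum>m\<in>A. f m) = (\<Sum>m\<in>A. affine_Euler_op d a (f m))"
    if "finite A" for A :: "nat set" and f
    using that
    by (induction A) (simp_all add: affine_Euler_op_def Euler_op_def pderiv_add smult_add_right
        algebra_simps)
  have hom: "affine_Euler_op d a (smult r p) = smult r (affine_Euler_op d a p)" for r p
    by (simp add: affine_Euler_op_def Euler_op_def pderiv_smult smult_add_right mult.commute)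
  have AT: "affine_Euler_op d a (T m p)
      = smult (real a + real d * real m) (T m p) + smult (real d) (T (Suc m) p)" for m p
    by (simp add: affine_Euler_op_def ET smult_add_left smult_add_right)
  have "(affine_Euler_op d a ^^ Suc n) p = (\<Sum>m\<le>Suc n. smult (c' m) (T m p))" for p
  proof -
    have "(affine_Euler_op d a ^^ Suc n) p = (\<Sum>m\<le>n. smult (c m) (affine_Euler_op d a (T m p)))"
      using c by (simp add: is_S2_row_def lin hom T_def)
    also have "\<dots> = (\<Sum>m\<le>n. smult ((real a + real d * real m) * c m) (T m p))
        + (\<Sum>m\<le>n. smult (real d * c m) (T (Suc m) p))"
      by (simp add: AT smult_add_right sum.distrib mult.commute)
    also have "(\<Sum>m\<le>n. smult ((real a + real d * real m) * c m) (T m p))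
        = (\<Sum>m\<le>Suc n. smult ((real a + real d * real m) * c m) (T m p))"
      using z[of "Suc n"] by simp
    also have "(\<Sum>m\<le>n. smult (real d * c m) (T (Suc m) p))
        = (\<Sum>m\<le>Suc n. smult (if m = 0 then 0 else real d * c (m - 1)) (T m p))"
      by (subst sum.atMost_Suc_shift) simp
    finally show ?thesis
      by (simp only: sum.distrib[symmetric] smult_add_left[symmetric] c'_def)
  qed
  moreover have "c' m = 0" if "m > Suc n" for m
    using that z[of m] z[of "m - 1"] by (simp add: c'_def)
  ultimately show ?case
    unfolding is_S2_row_def T_def by blast
qed

lemma is_S2_row_unique:
  assumes "is_S2_row d a n c" "\<forall>m>n. c m = 0" "is_S2_row d a n c'" "\<forall>m>n. c' m = 0"
  shows "c = c'"
proof
  fix j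
  show "c j = c' j"
  proof (induction j rule: less_induct)
    case (less j)
    show ?case
    proof (cases "j \<le> n")
      case True
      define t where "t m = coeff (monom (1 :: real) m * (pderiv ^^ m) (monom 1 j)) j" for m
      have t0: "t m = 0" if "m > j" for m
        using that by (simp add: t_def coeff_monom_mult)
      have tj: "t j \<noteq> 0"
        using pochhammer_pos[of "1 :: real" j]
        by (simp add: t_def coeff_monom_mult coeff_higher_pderiv)
      have "(\<Sum>m\<le>n. b m * t m) = coeff ((affine_Euler_op d a ^^ n) (monom 1 j)) j"
        if "is_S2_row d a n b" for b
        using that by (simp add: is_S2_row_def t_def coeff_sum)
      then have "(\<Sum>m\<le>n. c m * t m) = (\<Sum>m\<le>n. c' m * t m)"
        using assms(1,3) by simp
      then have "(\<Sum>m\<le>n. (c m - c' m) * t m) = 0"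
        by (simp add: left_diff_distrib sum_subtractf)
      moreover have "(\<Sum>m\<le>n. (c m - c' m) * t m) = (\<Sum>m\<in>{j}. (c m - c' m) * t m)"
        proof (rule sum.mono_neutral_right)
        show "\<forall>m\<in>{..n} - {j}. (c m - c' m) * t m = 0"
          using less t0 by (metis DiffD2 diff_self linorder_neqE_nat mult_eq_0_iff singletonI)
      qed (use True in auto)
      ultimately show ?thesis using tj by simp
    qed (use assms in simp)
  qed
qed

lemma is_S2_row_S2: "is_S2_row d a n (S2 d a n)" and S2_eq_0: "m > n \<Longrightarrow> S2 d a n m = 0"
proof -
  have "\<exists>!c. is_S2_row d a n c \<and> (\<forall>m>n. c m = 0)"
    using is_S2_row_exists is_S2_row_unique by blast
  from theI'[OF this] show "is_S2_row d a n (S2 d a n)" "m > n \<Longrightarrow> S2 d a n m = 0"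
    by (simp_all add: S2_def)
qed

end

(* The operator a 1 + d E multiplies the coefficient of x^j by a + d j, so the binomial theorem
   expresses S2(d,a;n,-) through the rows S2(1,0;m,-).  The generating polynomial of rEu(d,a;n,-) is
   the sum over j of S2(d,a;n,j) j! x^j (1-x)^(n-j); splitting (1-x)^(n-j) = (1-x)^(m-j) (1-x)^(n-m)
   and comparing coefficients gives the theorem. *)
theory Submission
  imports Defs
begin

lemma smult_sum_right: "smult c (\<Sum>i\<in>A. f i) = (\<Sum>i\<in>A. smult c (f i))"
  by (induction A rule: infinite_finite_induct) (simp_all add: smult_add_right)

lemma coeff_affine_Euler_op_funpow:
  "coeff ((affine_Euler_op d a ^^ n) p) j = (real a + real d * real j) ^ n * coeff p j"
proof -
  have "coeff (affine_Euler_op d a q) j = (real a + real d * real j) * coeff q j" for q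
    by (cases j)
      (simp_all add: affine_Euler_op_def Euler_op_def coeff_monom_mult coeff_pderiv ring_distribs)
  then show ?thesis
    by (induction n) simp_all
qed

text \<open>Both sides act diagonally on monomials, so comparing coefficients of x^j reduces the
  operator identity to the scalar binomial theorem for (d j + a)^n.\<close>

lemma affine_Euler_op_funpow_binomial:
  "(affine_Euler_op d a ^^ n) p =
    (\<Sum>m\<le>n. smult (real (n choose m) * real a ^ (n - m) * real d ^ m) ((affine_Euler_op 1 0 ^^ m) p))"
proof (rule poly_eqI)
  fix j
  have "(real a + real d * real j) ^ n =
      (\<Sum>m\<le>n. real (n choose m) * real a ^ (n - m) * real d ^ m * real j ^ m)"
    using binomial_ring[of "real d * real j" "real a" n]
    by (simp add: power_mult_distrib ac_simps)
  then show "coeff ((affine_Euler_op d a ^^ n) p) j = coeff (\<Sum>m\<le>n.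
      smult (real (n choose m) * real a ^ (n - m) * real d ^ m) ((affine_Euler_op 1 0 ^^ m) p)) j"
    by (simp add: coeff_sum coeff_affine_Euler_op_funpow sum_distrib_right mult.assoc)
qed

lemma S2_eqI:
  assumes "is_S2_row d a n c" and "\<And>m. m > n \<Longrightarrow> c m = 0"
  shows "S2 d a n = c"
  using is_S2_row_unique[OF is_S2_row_S2 _ assms(1)] assms(2) S2_eq_0 by blast

text \<open>Expanding each power of the Euler operator by its own row and collecting the multiples
  of \<open>T j p\<close> yields a row for \<open>d\<close>, \<open>a\<close>, \<open>n\<close>;
  uniqueness of rows identifies its coefficients.\<close>

lemma S2_binomial:
  "S2 d a n j = (\<Sum>m\<le>n. real (n choose m) * real a ^ (n - m) * real d ^ m * S2 1 0 m j)"
proof -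
  define w where "w m = real (n choose m) * real a ^ (n - m) * real d ^ m" for m
  define T where "T j p = monom 1 j * (pderiv ^^ j) p" for j and p :: "real poly"
  have "(affine_Euler_op d a ^^ n) p = (\<Sum>j\<le>n. smult (\<Sum>m\<le>n. w m * S2 1 0 m j) (T j p))" for p
  proof -
    have row: "(affine_Euler_op 1 0 ^^ m) p = (\<Sum>j\<le>n. smult (S2 1 0 m j) (T j p))"
      if "m \<le> n" for m
    proof -
      have "(affine_Euler_op 1 0 ^^ m) p = (\<Sum>j\<le>m. smult (S2 1 0 m j) (T j p))"
        using is_S2_row_S2[of 1 0 m] unfolding is_S2_row_def T_def by blast
      \<comment> \<open>Padding with the zero entries for j > m makes the range of j independent of
        m, so that the two sums can be exchanged.\<close>
      also have "\<dots> = (\<Sum>j\<le>n. smult (S2 1 0 m j) (T j p))"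
        using that by (intro sum.mono_neutral_left) (auto simp: S2_eq_0)
      finally show ?thesis .
    qed
    have "(affine_Euler_op d a ^^ n) p = (\<Sum>m\<le>n. smult (w m) (\<Sum>j\<le>n. smult (S2 1 0 m j) (T j p)))"
      unfolding affine_Euler_op_funpow_binomial[where d = d and a = a] w_def
      by (intro sum.cong refl) (simp only: row atMost_iff)
    also have "\<dots> = (\<Sum>m\<le>n. \<Sum>j\<le>n. smult (w m * S2 1 0 m j) (T j p))"
      by (simp add: smult_sum_right)
    also have "\<dots> = (\<Sum>j\<le>n. \<Sum>m\<le>n. smult (w m * S2 1 0 m j) (T j p))"
      by (rule sum.swap)
    finally show ?thesis
      by (simp add: smult_sum)
  qed
  then have "is_S2_row d a n (\<lambda>j. \<Sum>m\<le>n. w m * S2 1 0 m j)"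
    unfolding is_S2_row_def T_def by blast
  then have "S2 d a n = (\<lambda>j. \<Sum>m\<le>n. w m * S2 1 0 m j)"
    by (rule S2_eqI) (simp add: S2_eq_0)
  then show ?thesis
    by (simp add: w_def)
qed

text \<open>With F(y) the sum of S2(d,a;n,j) j! y^j, this is (1-x)^n F(x/(1-x)) with denominators
  cleared.\<close>

definition rEu_poly :: "nat \<Rightarrow> nat \<Rightarrow> nat \<Rightarrow> real poly"
  where "rEu_poly d a n =
    (\<Sum>j\<le>n. smult (S2 d a n j * fact j) (monom 1 j * [:1, -1:] ^ (n - j)))"

lemma coeff_one_minus_X_power:
  "coeff ([:1, -1:] ^ n) i = (-1) ^ i * (of_nat (n choose i) :: 'a :: comm_ring_1)"
proof (cases "i \<le> n")
  case True
  then show ?thesis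
    by (simp add: coeff_linear_poly_power mult.commute)
next
  case False
  moreover have "degree ([:1, -1 :: 'a:] ^ n) \<le> n"
    using degree_power_le[of "[:1, -1 :: 'a:]" n] by simp
  ultimately show ?thesis
    by (simp add: coeff_eq_0 binomial_eq_0)
qed

lemma coeff_rEu_poly: "coeff (rEu_poly d a n) k = rEu d a n k"
proof (cases "k \<le> n")
  case True
  have "coeff (rEu_poly d a n) k = (\<Sum>j\<le>n. if j \<le> k
      then (-1) ^ (k - j) * real ((n - j) choose (k - j)) * S2 d a n j * fact j else 0)"
    by (auto simp: rEu_poly_def coeff_sum coeff_monom_mult coeff_one_minus_X_power
        intro!: sum.cong)
  also have "\<dots> = (\<Sum>j\<le>k. (-1) ^ (k - j) * real ((n - j) choose (k - j)) * S2 d a n j * fact j)"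
    using True by (intro sum.mono_neutral_cong_right) auto
  finally show ?thesis
    using True by (simp add: rEu_def)
next
  case False
  then show ?thesis
    \<comment> \<open>For j \<le> n < k the binomial of n - j over k - j vanishes, in agreement with
      the value 0 prescribed for \<open>rEu\<close>.\<close>
    by (simp add: rEu_poly_def rEu_def coeff_sum coeff_monom_mult coeff_one_minus_X_power
        binomial_eq_0)
qed

text \<open>The map from rows to polynomials is linear, so \<open>S2_binomial\<close> carries over;
  the factor (1-x)^(n-m) turns the basis x^j (1-x)^(m-j) belonging to m into the one belonging to
  n.\<close>

lemma rEu_poly_binomial:
  "rEu_poly d a n = (\<Sum>m\<le>n. smult (real (n choose m) * real a ^ (n - m) * real d ^ m)
    (rEu_poly 1 0 m * [:1, -1:] ^ (n - m)))"
proof -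
  define w where "w m = real (n choose m) * real a ^ (n - m) * real d ^ m" for m
  define B where "B j = (monom 1 j * [:1, -1:] ^ (n - j) :: real poly)" for j
  have row: "rEu_poly 1 0 m * [:1, -1:] ^ (n - m) = (\<Sum>j\<le>n. smult (S2 1 0 m j * fact j) (B j))"
    if "m \<le> n" for m
  proof -
    \<comment> \<open>The exponents add up to n - j because j \<le> m \<le> n, so neither natural
      subtraction truncates.\<close>
    have "monom 1 j * [:1, -1:] ^ (m - j) * [:1, -1:] ^ (n - m) = B j" if "j \<le> m" for j
      using that \<open>m \<le> n\<close> by (simp add: B_def mult.assoc flip: power_add)
    then have "rEu_poly 1 0 m * [:1, -1:] ^ (n - m) = (\<Sum>j\<le>m. smult (S2 1 0 m j * fact j) (B j))"
      unfolding rEu_poly_def sum_distrib_right mult_smult_left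
      by (intro sum.cong refl) simp
    also have "\<dots> = (\<Sum>j\<le>n. smult (S2 1 0 m j * fact j) (B j))"
      using that by (intro sum.mono_neutral_left) (auto simp: S2_eq_0)
    finally show ?thesis .
  qed
  have "rEu_poly d a n = (\<Sum>j\<le>n. \<Sum>m\<le>n. smult (w m * (S2 1 0 m j * fact j)) (B j))"
    unfolding rEu_poly_def B_def[symmetric] S2_binomial[of d a n] w_def[symmetric]
    by (simp add: sum_distrib_right smult_sum mult.assoc)
  also have "\<dots> = (\<Sum>m\<le>n. \<Sum>j\<le>n. smult (w m * (S2 1 0 m j * fact j)) (B j))"
    by (rule sum.swap)
  also have "\<dots> = (\<Sum>m\<le>n. smult (w m) (rEu_poly 1 0 m * [:1, -1:] ^ (n - m)))"
    by (intro sum.cong refl) (simp only: row atMost_iff smult_sum_right smult_smult)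
  finally show ?thesis
    unfolding w_def .
qed

theorem mainTheorem10:
  fixes d a n k :: nat
  assumes "d \<ge> 1" and "k \<le> n"
  shows "rEu d a n k =
    (\<Sum>m\<le>n. real (n choose m) * real a ^ (n - m) * real d ^ m *
      (\<Sum>p\<le>k. (-1) ^ (k - p) * real ((n - m) choose (k - p)) * rEu 1 0 m p))"
proof -
  have "rEu d a n k = coeff (rEu_poly d a n) k"
    by (simp add: coeff_rEu_poly)
  also have "\<dots> = (\<Sum>m\<le>n. real (n choose m) * real a ^ (n - m) * real d ^ m *
      (\<Sum>p\<le>k. (-1) ^ (k - p) * real ((n - m) choose (k - p)) * rEu 1 0 m p))"
    \<comment> \<open>The inner sum over p is the Cauchy product for the coefficient of x^k in
      \<open>rEu_poly 1 0 m\<close> times (1-x)^(n-m).\<close>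
    unfolding rEu_poly_binomial[of d a n]
    by (simp add: coeff_sum coeff_mult coeff_rEu_poly coeff_one_minus_X_power mult.commute)
  finally show ?thesis .
qed

end
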